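(* Let $\Delta$ be either a cone $\Delta_\kappa$ (for some $\kappa\in(0,1)$) or a cone $\Delta_\omega$ (for some sequence $\omega$ as in the context), and let $(\Omega_k(n))_{k,n\in\mathbb{N}}$ be a system of weights (that is, $0<\Omega_{k-1}(n)\le\Omega_k(n)$ for all $k\ge1$, $n\in\mathbb{N}$) which is $\Delta$-admissible. Then the following statements are equivalent: (i) $$\lim_{(k,n)_\Delta\to\infty}\frac{\Omega_k(n)}{\Omega_{k-1}(n)}=1;$$ (ii) there exists a sequence of divergence with respect to $(\Omega_k(n))$.
   Context: Notation: $\mathbb{P}=\{1,2,\dots\}$, $\mathbb{N}=\mathbb{P}\cup\{0\}$. For $n\in\mathbb{P}$, $|n|:=\lfloor\log_2 n\rfloor$ is the position of the highest nonzero binary digit of $n$. Cones: for $\kappa\in(0,1)$, $\Delta_\kappa:=\{(k,n)\in\mathbb{N}\times\mathbb{P}:\kappa|n|<k\le|n|\}$. For a nondecreasing sequence $\omega=(\omega_n)$ of positive integers with $\omega_n\to\infty$ and $|n|/\omega_n\to\infty$ as $n\to\infty$, $\Delta_\omega:=\{(k,n)\in\mathbb{N}\times\mathbb{P}:|n|-\omega_n<k\le|n|\}$. For a family $(a_k(n))_{(k,n)\in\Delta}$ and a number $L$, $\lim_{(k,n)_\Delta\to\infty}a_k(n)=L$ means: for every $\varepsilon>0$ there is $N_0$ such that $|a_k(n)-L|<\varepsilon$ whenever $(k,n)\in\Delta$ and $|n|\ge N_0$. The system $(\Omega_k(n))$ is $\Delta$-admissible if (a) there is a finite limit $\lim_{(k,n)_\Delta\to\infty}\Omega_k(n)/\Omega_{k-1}(n)$,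 and (b) there are constants $0<c\le C<\infty$ with $c\le\Omega_{|n|}(n)\le C$ for all $n\in\mathbb{P}$. A sequence $\gamma=(\gamma(n))_{n\in\mathbb{P}}$ of positive integers is a sequence of divergence with respect to $(\Omega_k(n))$ if (i) $\lim_{N\to\infty}\inf\{\gamma(n):n\in\mathbb{P},\,|n|\ge N\}=\infty$; and there is $N_0\ge1$ such that (ii) $\sup\{\gamma(n)/|n|:n\in\mathbb{P},\,|n|\ge N_0\}<1$, and (iii) there is a constant $c>0$ with $\Omega_{|n|-\gamma(n)}(n)\ge c$ for all $n\in\mathbb{P}$ with $|n|\ge N_0$. *)

theory Defs
  imports "HOL-Analysis.Analysis"
begin

text \<open>Throughout, \<open>\<Omega> k n\<close> stands for the weight $\Omega_k(n)$ (lower index first), and sequences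
  indexed by the positive integers are functions on \<^typ>\<open>nat\<close> whose value at \<open>0\<close> is irrelevant.\<close>

text \<open>$|n| = \lfloor \log_2 n \rfloor$, meaningful for \<open>n \<ge> 1\<close> only.\<close>

definition bitpos :: "nat \<Rightarrow> nat" where
  "bitpos n = nat \<lfloor>log 2 (real n)\<rfloor>"

definition cone_kappa :: "real \<Rightarrow> (nat \<times> nat) set" where
  "cone_kappa \<kappa> = {(k, n). n \<ge> 1 \<and> \<kappa> * real (bitpos n) < real k \<and> k \<le> bitpos n}"

definition cone_sequence :: "(nat \<Rightarrow> nat) \<Rightarrow> bool" where
  "cone_sequence \<omega> \<longleftrightarrow>
     (\<forall>n\<ge>1. \<omega> n \<ge> 1) \<and> mono_on {1..} \<omega> \<and>
     filterlim \<omega> at_top sequentially \<and>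
     filterlim (\<lambda>n. real (bitpos n) / real (\<omega> n)) at_top sequentially"

text \<open>The lower bound $|n| - \omega_n$ is taken in the integers: it may be negative for
  small \<open>n\<close>.\<close>

definition cone_omega :: "(nat \<Rightarrow> nat) \<Rightarrow> (nat \<times> nat) set" where
  "cone_omega \<omega> =
     {(k, n). n \<ge> 1 \<and> int (bitpos n) - int (\<omega> n) < int k \<and> k \<le> bitpos n}"

definition cone_lim :: "(nat \<times> nat) set \<Rightarrow> (nat \<Rightarrow> nat \<Rightarrow> real) \<Rightarrow> real \<Rightarrow> bool" where
  "cone_lim \<Delta> a L \<longleftrightarrow>
     (\<forall>\<epsilon>>0. \<exists>N0. \<forall>(k, n)\<in>\<Delta>. bitpos n \<ge> N0 \<longrightarrow> \<bar>a k n - L\<bar> < \<epsilon>)"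

definition weights :: "(nat \<Rightarrow> nat \<Rightarrow> real) \<Rightarrow> bool" where
  "weights \<Omega> \<longleftrightarrow> (\<forall>k\<ge>1. \<forall>n. 0 < \<Omega> (k - 1) n \<and> \<Omega> (k - 1) n \<le> \<Omega> k n)"

text \<open>A pair \<open>(0, n)\<close>, for which $\Omega_{k-1}(n)$ makes no sense, never lies in a cone
  $\Delta_\kappa$, and lies in $\Delta_\omega$ only if $|n| < \omega_n$, hence for finitely many
  \<open>n\<close> only. So the truncated subtraction \<open>k - 1\<close> does not affect the limit.\<close>

definition cone_admissible :: "(nat \<times> nat) set \<Rightarrow> (nat \<Rightarrow> nat \<Rightarrow> real) \<Rightarrow> bool" where
  "cone_admissible \<Delta> \<Omega> \<longleftrightarrow>
     (\<exists>L. cone_lim \<Delta> (\<lambda>k n. \<Omega> k n / \<Omega> (k - 1) n) L) \<and>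
     (\<exists>c C. 0 < c \<and> c \<le> C \<and> (\<forall>n\<ge>1. c \<le> \<Omega> (bitpos n) n \<and> \<Omega> (bitpos n) n \<le> C))"

text \<open>The supremum is taken in \<^typ>\<open>ereal\<close>, so that it is \<open>\<infinity>\<close> for an unbounded set. If it
  is less than \<open>1\<close>, then $\gamma(n) < |n|$ for all \<open>n\<close> with $|n| \ge N_0$, so the subtraction in
  the last condition is not truncated.\<close>

definition divergence_sequence :: "(nat \<Rightarrow> nat \<Rightarrow> real) \<Rightarrow> (nat \<Rightarrow> nat) \<Rightarrow> bool" where
  "divergence_sequence \<Omega> \<gamma> \<longleftrightarrow>
     (\<forall>n\<ge>1. \<gamma> n \<ge> 1) \<and>
     filterlim (\<lambda>N. INF n\<in>{n. n \<ge> 1 \<and> bitpos n \<ge> N}. \<gamma> n) at_top sequentially \<and>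
     (\<exists>N0\<ge>1.
        (SUP n\<in>{n. n \<ge> 1 \<and> bitpos n \<ge> N0}. ereal (real (\<gamma> n) / real (bitpos n))) < 1 \<and>
        (\<exists>c>0. \<forall>n\<ge>1. bitpos n \<ge> N0 \<longrightarrow> \<Omega> (bitpos n - \<gamma> n) n \<ge> c))"

end

theory Submission
  imports Defs
begin

text \<open>A cone enters the argument only through one property: for each fixed \<open>m\<close> it contains
  the point $(|n| - m, n)$ for all large \<open>n\<close>. Multiplying the \<open>m\<close> topmost consecutive quotients
  therefore turns a cone limit \<open>L\<close> of $\Omega_k(n)/\Omega_{k-1}(n)$ into
  $\Omega_{|n|}(n)/\Omega_{|n|-m}(n) \to L^m$ for every fixed \<open>m\<close>
  (\<open>top_ratio_tendsto_power\<close>). By monotonicity of the weights, $L \ge 1$.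

  If \<open>\<gamma>\<close> is a sequence of divergence, then $\gamma(n) \ge m$ for large \<open>n\<close>, hence
  $\Omega_{|n|-m}(n) \ge \Omega_{|n|-\gamma(n)}(n)$ is bounded below. Since $\Omega_{|n|}(n)$ is
  bounded above, the powers $L^m$ are bounded uniformly in \<open>m\<close>, which forces \<open>L = 1\<close>
  (\<open>divergence_imp_limit_le_1\<close>).

  If conversely \<open>L = 1\<close>, then for each fixed \<open>m\<close> the weight $\Omega_{|n|-m}(n)$ is eventually at
  least half of the lower bound of $\Omega_{|n|}(n)$. Letting $\gamma(n)$ be the largest
  $m \le |n|/2$ with that property is a diagonal choice that tends to infinity
  (\<open>divergence_sequence_exists\<close>).\<close>

lemma bitpos_power: "bitpos (2 ^ N) = N"
  by (simp add: bitpos_def log_nat_power)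

lemma bitpos_le: "bitpos n \<le> n"
proof (cases "n = 0")
  case False
  have "real n \<le> 2 powr real n"
    by (metis less_exp of_nat_less_iff of_nat_numeral of_nat_power order_less_imp_le
        powr_realpow zero_less_numeral)
  then have "log 2 (real n) \<le> real n"
    using False by (simp add: log_le_iff)
  then show ?thesis
    unfolding bitpos_def by linarith
qed (simp add: bitpos_def log_def)

lemma bitpos_at_top: "filterlim bitpos at_top sequentially"
  unfolding filterlim_at_top
proof
  fix N
  show "\<forall>\<^sub>F n in sequentially. N \<le> bitpos n"
    using eventually_ge_at_top[of "2 ^ N"]
  proof eventually_elim
    case (elim n)
    then have "(2::real) ^ N \<le> real n"
      by (metis of_nat_le_iff of_nat_numeral of_nat_power)
    moreover from this have "0 < real n"
      using zero_less_power[of "2::real" N] by linarith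
    ultimately have "real N \<le> log 2 (real n)"
      by (simp add: le_log_iff powr_realpow)
    then show ?case
      unfolding bitpos_def by linarith
  qed
qed

text \<open>Because $|n| \le n$, a condition that holds for all large \<open>n\<close> also holds for all \<open>n\<close> with
  $|n|$ large; together with the divergence of $|n|$ this makes the limits \<open>n \<rightarrow> \<infinity>\<close> and
  $|n| \to \infty$ interchangeable.\<close>

lemma eventually_bitpos_threshold:
  assumes "eventually P sequentially"
  obtains N where "\<And>n. bitpos n \<ge> N \<Longrightarrow> P n"
  using assms bitpos_le unfolding eventually_sequentially by (meson le_trans)

lemma cone_kappa_contains_top:
  assumes "\<kappa> < 1"
  shows "\<forall>\<^sub>F n in sequentially. (bitpos n - m, n) \<in> cone_kappa \<kappa>"
proof -
  define N where "N = max m (nat \<lceil>real m / (1 - \<kappa>)\<rceil> + 1)"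
  show ?thesis
    using filterlim_at_top[THEN iffD1, OF bitpos_at_top, rule_format, of N]
      eventually_ge_at_top[of 1]
  proof eventually_elim
    case (elim n)
    then have "real m / (1 - \<kappa>) < real (bitpos n)"
      unfolding N_def by linarith
    then have "real m < real (bitpos n) * (1 - \<kappa>)"
      using assms by (simp add: pos_divide_less_eq)
    moreover have "real (bitpos n - m) = real (bitpos n) - real m"
      using elim by (simp add: N_def of_nat_diff)
    ultimately show ?case
      using elim by (simp add: cone_kappa_def algebra_simps)
  qed
qed

lemma cone_omega_contains_top:
  assumes "cone_sequence \<omega>"
  shows "\<forall>\<^sub>F n in sequentially. (bitpos n - m, n) \<in> cone_omega \<omega>"
proof -
  have "filterlim \<omega> at_top sequentially"
    using assms by (simp add: cone_sequence_def)
  then have "\<forall>\<^sub>F n in sequentially. Suc m \<le> \<omega> n"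
    by (simp add: filterlim_at_top)
  then show ?thesis
    using filterlim_at_top[THEN iffD1, OF bitpos_at_top, rule_format, of m]
      eventually_ge_at_top[of 1]
    by eventually_elim (auto simp: cone_omega_def of_nat_diff)
qed

lemma weights_pos: "weights \<Omega> \<Longrightarrow> 0 < \<Omega> k n"
  unfolding weights_def by (metis diff_Suc_1 le_add1 plus_1_eq_Suc)

lemma weights_mono:
  assumes "weights \<Omega>" "j \<le> k"
  shows "\<Omega> j n \<le> \<Omega> k n"
proof -
  have "\<Omega> i n \<le> \<Omega> (Suc i) n" for i
    using assms(1) unfolding weights_def by (metis diff_Suc_1 le_add1 plus_1_eq_Suc)
  then show ?thesis
    using lift_Suc_mono_le[of "\<lambda>i. \<Omega> i n"] assms(2) by blast
qed

lemma cone_lim_imp_tendsto: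
  assumes lim: "cone_lim \<Delta> a L"
    and top: "\<forall>\<^sub>F n in sequentially. (f n, n) \<in> \<Delta>"
  shows "(\<lambda>n. a (f n) n) \<longlonglongrightarrow> L"
proof (rule tendstoI)
  fix e :: real
  assume "e > 0"
  then obtain N where N: "\<forall>(k, n)\<in>\<Delta>. bitpos n \<ge> N \<longrightarrow> \<bar>a k n - L\<bar> < e"
    using lim unfolding cone_lim_def by blast
  show "\<forall>\<^sub>F n in sequentially. dist (a (f n) n) L < e"
    using top filterlim_at_top[THEN iffD1, OF bitpos_at_top, rule_format, of N]
    by eventually_elim (use N in \<open>auto simp: dist_real_def\<close>)
qed

text \<open>The quotient telescopes into \<open>m\<close> quotients of consecutive weights, each taken along points
  of the cone and hence convergent to \<open>L\<close>.\<close>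

lemma top_ratio_tendsto_power:
  assumes weights: "weights \<Omega>"
    and top: "\<And>m. \<forall>\<^sub>F n in sequentially. (bitpos n - m, n) \<in> \<Delta>"
    and lim: "cone_lim \<Delta> (\<lambda>k n. \<Omega> k n / \<Omega> (k - 1) n) L"
  shows "(\<lambda>n. \<Omega> (bitpos n) n / \<Omega> (bitpos n - m) n) \<longlonglongrightarrow> L ^ m"
proof (induction m)
  case 0
  show ?case
    using weights_pos[OF weights] by (simp add: less_imp_neq[THEN not_sym])
next
  case (Suc m)
  have "(\<lambda>n. \<Omega> (bitpos n - m) n / \<Omega> (bitpos n - m - 1) n) \<longlonglongrightarrow> L"
    by (rule cone_lim_imp_tendsto[OF lim top])
  from tendsto_mult[OF this Suc.IH] show ?case
    using weights_pos[OF weights] by (simp add: less_imp_neq[THEN not_sym])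
qed

lemma divergence_sequence_at_top:
  assumes "divergence_sequence \<Omega> \<gamma>"
  shows "filterlim \<gamma> at_top sequentially"
  unfolding filterlim_at_top
proof
  fix m
  have "filterlim (\<lambda>N. INF n\<in>{n. n \<ge> 1 \<and> bitpos n \<ge> N}. \<gamma> n) at_top sequentially"
    using assms by (simp add: divergence_sequence_def)
  then obtain N where N: "m \<le> (INF n\<in>{n. n \<ge> 1 \<and> bitpos n \<ge> N}. \<gamma> n)"
    unfolding filterlim_at_top eventually_sequentially by blast
  show "\<forall>\<^sub>F n in sequentially. m \<le> \<gamma> n"
    using filterlim_at_top[THEN iffD1, OF bitpos_at_top, rule_format, of N]
      eventually_ge_at_top[of 1]
  proof eventually_elim
    case (elim n)
    then have "(INF n\<in>{n. n \<ge> 1 \<and> bitpos n \<ge> N}. \<gamma> n) \<le> \<gamma> n"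
      by (intro cINF_lower) auto
    with N show ?case
      by linarith
  qed
qed

text \<open>The bound \<open>C / c\<close> on the quotients $\Omega_{|n|}(n)/\Omega_{|n|-m}(n)$, and hence on their
  limit $L^m$, does not depend on \<open>m\<close>.\<close>

lemma divergence_imp_limit_le_1:
  assumes weights: "weights \<Omega>"
    and upper: "\<And>n. n \<ge> 1 \<Longrightarrow> \<Omega> (bitpos n) n \<le> C"
    and ratio: "\<And>m. (\<lambda>n. \<Omega> (bitpos n) n / \<Omega> (bitpos n - m) n) \<longlonglongrightarrow> L ^ m"
    and div: "divergence_sequence \<Omega> \<gamma>"
  shows "L \<le> 1"
proof (rule ccontr)
  assume "\<not> L \<le> 1"
  obtain N c where c: "c > 0" "\<And>n. n \<ge> 1 \<Longrightarrow> bitpos n \<ge> N \<Longrightarrow> \<Omega> (bitpos n - \<gamma> n) n \<ge> c"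
    using div unfolding divergence_sequence_def by blast
  have "L ^ m \<le> C / c" for m
  proof (rule tendsto_upperbound[OF ratio])
    show "\<forall>\<^sub>F n in sequentially. \<Omega> (bitpos n) n / \<Omega> (bitpos n - m) n \<le> C / c"
      using filterlim_at_top[THEN iffD1, OF bitpos_at_top, rule_format, of N]
        filterlim_at_top[THEN iffD1, OF divergence_sequence_at_top[OF div], rule_format, of m]
        eventually_ge_at_top[of 1]
    proof eventually_elim
      case (elim n)
      have "c \<le> \<Omega> (bitpos n - \<gamma> n) n"
        using c(2) elim by blast
      also have "\<dots> \<le> \<Omega> (bitpos n - m) n"
        using elim by (intro weights_mono[OF weights]) simp
      finally show ?case
        using upper[of n] weights_pos[OF weights, of "bitpos n" n] c(1) elim
        by (intro frac_le) auto
    qed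
  qed simp
  moreover obtain m where "C / c < L ^ m"
    using real_arch_pow[of L "C / c"] \<open>\<not> L \<le> 1\<close> by auto
  ultimately show False
    by (meson not_less)
qed

text \<open>A pointwise eventual lower bound, for each fixed depth \<open>m\<close> below the top index, is enough:
  the largest depth at which the bound already holds at \<open>n\<close> grows without bound.\<close>

lemma divergence_sequence_exists:
  assumes c: "c > 0"
    and lower: "\<And>m. \<forall>\<^sub>F n in sequentially. c \<le> \<Omega> (bitpos n - m) n"
  shows "\<exists>\<gamma>. divergence_sequence \<Omega> \<gamma>"
proof -
  \<comment> \<open>The cap \<open>2 * m \<le> bitpos n\<close> makes the set finite and keeps $\gamma(n)/|n|$ at most \<open>1/2\<close>; the
    element \<open>1\<close> keeps \<open>\<gamma>\<close> positive at the finitely many \<open>n\<close> where no positive depth qualifies.\<close>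
  define A where "A n = {m. 2 * m \<le> bitpos n \<and> c \<le> \<Omega> (bitpos n - m) n}" for n
  define \<gamma> where "\<gamma> n = Max (insert 1 (A n))" for n
  have fin: "finite (A n)" for n
    by (rule finite_subset[of _ "{..bitpos n}"]) (auto simp: A_def)
  have ev_A: "\<forall>\<^sub>F n in sequentially. m \<in> A n" for m
    using lower[of m] filterlim_at_top[THEN iffD1, OF bitpos_at_top, rule_format, of "2 * m"]
    by eventually_elim (auto simp: A_def)
  have \<gamma>_ge: "m \<le> \<gamma> n" if "m \<in> A n" for m n
    unfolding \<gamma>_def using fin that by (intro Max_ge) auto
  have pos: "1 \<le> \<gamma> n" for n
    unfolding \<gamma>_def using fin by (intro Max_ge) auto
  obtain N1 where N1: "\<And>n. bitpos n \<ge> N1 \<Longrightarrow> 1 \<in> A n"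
    using eventually_bitpos_threshold[OF ev_A[of 1]] by blast
  have \<gamma>_in: "\<gamma> n \<in> A n" if "bitpos n \<ge> N1" for n
    using Max_in[of "insert 1 (A n)"] fin N1[OF that] by (auto simp: \<gamma>_def insert_absorb)
  define N0 where "N0 = max 1 N1"
  have "filterlim (\<lambda>N. INF n\<in>{n. n \<ge> 1 \<and> bitpos n \<ge> N}. \<gamma> n) at_top sequentially"
    unfolding filterlim_at_top
  proof
    fix m
    obtain M where M: "\<And>n. bitpos n \<ge> M \<Longrightarrow> m \<in> A n"
      using eventually_bitpos_threshold[OF ev_A[of m]] by blast
    have "m \<le> (INF n\<in>{n. n \<ge> 1 \<and> bitpos n \<ge> N}. \<gamma> n)" if "N \<ge> M" for N
    proof (rule cINF_greatest)
      have "2 ^ N \<in> {n. n \<ge> 1 \<and> bitpos n \<ge> N}"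
        by (simp add: bitpos_power)
      then show "{n. n \<ge> 1 \<and> bitpos n \<ge> N} \<noteq> {}"
        by blast
    qed (use M that \<gamma>_ge in auto)
    then show "\<forall>\<^sub>F N in sequentially. m \<le> (INF n\<in>{n. n \<ge> 1 \<and> bitpos n \<ge> N}. \<gamma> n)"
      unfolding eventually_sequentially by blast
  qed
  moreover have "(SUP n\<in>{n. n \<ge> 1 \<and> bitpos n \<ge> N0}. ereal (real (\<gamma> n) / real (bitpos n))) < 1"
  proof (rule le_less_trans)
    show "(SUP n\<in>{n. n \<ge> 1 \<and> bitpos n \<ge> N0}. ereal (real (\<gamma> n) / real (bitpos n)))
          \<le> ereal (1 / 2)"
    proof (rule SUP_least)
      fix n
      assume "n \<in> {n. n \<ge> 1 \<and> bitpos n \<ge> N0}"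
      then have "bitpos n \<ge> 1" and "2 * \<gamma> n \<le> bitpos n"
        using \<gamma>_in[of n] by (auto simp: N0_def A_def)
      then show "ereal (real (\<gamma> n) / real (bitpos n)) \<le> ereal (1 / 2)"
        by (simp add: divide_simps)
    qed
  qed (simp add: one_ereal_def)
  moreover have "\<Omega> (bitpos n - \<gamma> n) n \<ge> c" if "bitpos n \<ge> N0" for n
    using \<gamma>_in[of n] that by (simp add: N0_def A_def)
  moreover have "N0 \<ge> 1"
    by (simp add: N0_def)
  ultimately have "divergence_sequence \<Omega> \<gamma>"
    unfolding divergence_sequence_def using pos c by blast
  then show ?thesis
    by blast
qed

theorem theorem2:
  fixes \<Delta> :: "(nat \<times> nat) set" and \<Omega> :: "nat \<Rightarrow> nat \<Rightarrow> real"
  assumes cone: "(\<exists>\<kappa>. 0 < \<kappa> \<and> \<kappa> < 1 \<and> \<Delta> = cone_kappa \<kappa>) \<or>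
                 (\<exists>\<omega>. cone_sequence \<omega> \<and> \<Delta> = cone_omega \<omega>)"
    and weights: "weights \<Omega>"
    and admissible: "cone_admissible \<Delta> \<Omega>"
  shows "cone_lim \<Delta> (\<lambda>k n. \<Omega> k n / \<Omega> (k - 1) n) 1 \<longleftrightarrow>
         (\<exists>\<gamma>. divergence_sequence \<Omega> \<gamma>)"
proof -
  have top: "\<forall>\<^sub>F n in sequentially. (bitpos n - m, n) \<in> \<Delta>" for m
    using cone cone_kappa_contains_top cone_omega_contains_top by blast
  obtain c C where c: "c > 0"
    and lower: "\<And>n. n \<ge> 1 \<Longrightarrow> c \<le> \<Omega> (bitpos n) n"
    and upper: "\<And>n. n \<ge> 1 \<Longrightarrow> \<Omega> (bitpos n) n \<le> C"
    using admissible unfolding cone_admissible_def by blast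
  note pos = weights_pos[OF weights]
  show ?thesis
  proof
    assume "cone_lim \<Delta> (\<lambda>k n. \<Omega> k n / \<Omega> (k - 1) n) 1"
    note ratio = top_ratio_tendsto_power[OF weights top this]
    have "\<forall>\<^sub>F n in sequentially. c / 2 \<le> \<Omega> (bitpos n - m) n" for m
    proof -
      have "\<forall>\<^sub>F n in sequentially. \<Omega> (bitpos n) n / \<Omega> (bitpos n - m) n < 2"
        using order_tendstoD(2)[OF ratio[of m], of 2] by simp
      then show ?thesis
        using eventually_ge_at_top[of 1]
      proof eventually_elim
        case (elim n)
        then have "\<Omega> (bitpos n) n < 2 * \<Omega> (bitpos n - m) n"
          using pos[of "bitpos n - m" n] by (simp add: pos_divide_less_eq)
        with lower[of n] elim show ?case
          by simp
      qed
    qed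
    with c show "\<exists>\<gamma>. divergence_sequence \<Omega> \<gamma>"
      by (intro divergence_sequence_exists[of "c / 2"]) auto
  next
    assume "\<exists>\<gamma>. divergence_sequence \<Omega> \<gamma>"
    then obtain \<gamma> where \<gamma>: "divergence_sequence \<Omega> \<gamma>" ..
    obtain L where L: "cone_lim \<Delta> (\<lambda>k n. \<Omega> k n / \<Omega> (k - 1) n) L"
      using admissible unfolding cone_admissible_def by blast
    note ratio = top_ratio_tendsto_power[OF weights top L]
    have "L \<le> 1"
      using divergence_imp_limit_le_1[OF weights upper ratio \<gamma>] by blast
    moreover have "1 \<le> \<Omega> (bitpos n) n / \<Omega> (bitpos n - 1) n" for n
      using pos[of "bitpos n - 1" n] weights_mono[OF weights, of "bitpos n - 1" "bitpos n" n]
      by (simp add: le_divide_eq)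
    then have "1 \<le> L"
      using tendsto_lowerbound[OF ratio[of 1], of 1] by simp
    ultimately show "cone_lim \<Delta> (\<lambda>k n. \<Omega> k n / \<Omega> (k - 1) n) 1"
      using L by simp
  qed
qed

end
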